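(* Let $b=1$ and $T(z)=\sum_{n\ge1}n^{n-1}z^n/n!$. Then $$FC_0(z,w,q)=\frac{(1-T(zwq))^2-(1-T(zw))^2}{2(1-q)(1-T(zw))}.$$
   Context: Bucket capacity $b=1$. For $m\ge1$ consider full hash tables: $m$ buckets $1,\dots,m$ (cyclic) and $m$ keys labelled $1,\dots,m$ with hash addresses in $\{1,\dots,m\}$, inserted in label order by linear probing (each key placed in the first empty bucket among $h(x),h(x)+1,\dots$ cyclically, never moved), such that the last inserted key (label $m$) is placed in bucket $m$. The displacement of a key is the number of buckets it passes beyond its hash address. $FC_0(z,w,q)=\sum_{m\ge1}\sum q^{\text{displacement of }\bullet}\,w^m\frac{z^m}{m!}$, where the inner sum runs over all such tables together with a marked key $\bullet$ among the $m$ keys. *)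

theory Defs
  imports "HOL-Computational_Algebra.Formal_Power_Series" "HOL-Library.FuncSet"
begin

text \<open>
  A table is given by its hash function \<open>h\<close>, taken extensional on the set \<open>{1..m}\<close> of keys
  so that tables are counted correctly; the final arrangement is determined by \<open>h\<close>.
\<close>

text \<open>The bucket reached from address \<open>a\<close> in \<open>d\<close> cyclic steps, buckets being numbered from 1.\<close>

definition probe :: "nat \<Rightarrow> nat \<Rightarrow> nat \<Rightarrow> nat" where
  "probe m a d = (a - 1 + d) mod m + 1"

definition probe_steps :: "nat \<Rightarrow> nat set \<Rightarrow> nat \<Rightarrow> nat" where
  "probe_steps m B a = (LEAST d. probe m a d \<notin> B)"

text \<open>The set of occupied buckets after keys \<open>1, \<dots>, k\<close> have been inserted in this order.\<close>

fun occupied :: "nat \<Rightarrow> (nat \<Rightarrow> nat) \<Rightarrow> nat \<Rightarrow> nat set" where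
  "occupied m h 0 = {}"
| "occupied m h (Suc k) =
     insert (probe m (h (Suc k)) (probe_steps m (occupied m h k) (h (Suc k)))) (occupied m h k)"

definition displacement :: "nat \<Rightarrow> (nat \<Rightarrow> nat) \<Rightarrow> nat \<Rightarrow> nat" where
  "displacement m h x = probe_steps m (occupied m h (x - 1)) (h x)"

definition bucket :: "nat \<Rightarrow> (nat \<Rightarrow> nat) \<Rightarrow> nat \<Rightarrow> nat" where
  "bucket m h x = probe m (h x) (displacement m h x)"

definition full_tables :: "nat \<Rightarrow> (nat \<Rightarrow> nat) set" where
  "full_tables m = {h \<in> {1..m} \<rightarrow>\<^sub>E {1..m}. bucket m h m = m}"

text \<open>
  Generating functions are formal power series in \<open>z\<close> over a field of characteristic 0
  containing \<open>w\<close> and \<open>q\<close>.  Taking the field of rational functions in two indeterminates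
  \<open>w\<close> and \<open>q\<close> gives the series in which all three variables are formal.
\<close>

definition FC0 :: "'a::field_char_0 \<Rightarrow> 'a \<Rightarrow> 'a fps" where
  "FC0 w q = Abs_fps (\<lambda>m. if m = 0 then 0
     else (\<Sum>(h, x) \<in> full_tables m \<times> {1..m}. q ^ displacement m h x) * w ^ m / fact m)"

text \<open>The case distinction is needed because \<open>0 ^ (0 - 1) = 1\<close> on the natural numbers.\<close>

definition tree_fps :: "'a::field_char_0 fps" where
  "tree_fps = Abs_fps (\<lambda>n. if n = 0 then 0 else of_nat (n ^ (n - 1)) / fact n)"

text \<open>The series \<open>T(c z)\<close>.\<close>

definition T :: "'a::field_char_0 \<Rightarrow> 'a fps" where
  "T c = fps_compose tree_fps (fps_const c * fps_X)"

end

theory Submission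
  imports Defs
begin

text \<open>
  The displacement of a key is invariant under cyclic rotation of the addresses and depends only on
  the keys up to it. Hence the sum of \<open>q ^ d\<close> over full tables, where \<open>d\<close> is the displacement
  of key \<open>x\<close>, is \<open>m ^ (m - x)\<close> times the same sum over tables with \<open>x\<close> keys
  whose last key lands in bucket \<open>m\<close>. Before that key arrives bucket \<open>m\<close> is empty; if the last
  empty bucket before \<open>m\<close> is \<open>m - k\<close>, the key has displacement \<open>0, \<dots>, k - 1\<close>,
  and the other keys split into two independent parking problems, on \<open>k\<close> and on \<open>m - k\<close> buckets.
  Summed over \<open>x\<close>, the product of their counts telescopes, and the coefficient becomes
  \<open>\<Sum>\<^sub>k (m choose k) k ^ (k - 2) [k]\<^sub>q (m - k) ^ (m - k)\<close>, a product of exponential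
  generating functions. Its factors are expressed in \<open>T\<close> by Abel's identity,
  which is the case \<open>q = 1\<close> of the same count.
\<close>

subsection \<open>Counting parking functions\<close>

text \<open>Address functions for which linear probing along \<open>1, \<dots>, M\<close> leaves bucket \<open>M\<close> empty.\<close>

definition park :: "'k set \<Rightarrow> nat \<Rightarrow> ('k \<Rightarrow> nat) set" where
  "park A M = {g \<in> A \<rightarrow>\<^sub>E {1..M}. \<forall>a\<in>{1..M}. card {x\<in>A. a \<le> g x} \<le> M - a}"

text \<open>Cutting at address \<open>p\<close> is a bijection: keys of \<open>B\<close> are shifted
  down by \<open>p\<close>, the others keep their addresses, and the two parts are chosen
  independently. It serves with \<open>p = 1\<close> to remove the first bucket in
  \<open>card_park\<close>, and with general \<open>p\<close> in
  \<open>card_park_pieces\<close>.\<close>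

lemma card_split:
  assumes "B \<subseteq> A" "U \<subseteq> B \<rightarrow>\<^sub>E {1..k::nat}" "V \<subseteq> (A - B) \<rightarrow>\<^sub>E {1..p}"
  shows "card {g \<in> A \<rightarrow>\<^sub>E {1..p + k}. {x\<in>A. p < g x} = B \<and> (\<lambda>x\<in>B. g x - p) \<in> U \<and>
           restrict g (A - B) \<in> V} = card U * card V" (is "card ?S = _")
proof -
  define F where "F = (\<lambda>g. (\<lambda>x\<in>B. g x - p, restrict g (A - B)))"
  define G where "G = (\<lambda>(u, v). \<lambda>x\<in>A. if x \<in> B then u x + p else v x :: nat)"
  have G: "G (u, v) \<in> ?S \<and> F (G (u, v)) = (u, v)" if "u \<in> U" "v \<in> V" for u v
  proof -
    from that assms have u: "u \<in> B \<rightarrow>\<^sub>E {1..k}" and v: "v \<in> (A - B) \<rightarrow>\<^sub>E {1..p}" by blast+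
    have ub: "1 \<le> u x" "u x \<le> k" if "x \<in> B" for x using PiE_mem[OF u that] by simp_all
    have vb: "1 \<le> v x" "v x \<le> p" if "x \<in> A" "x \<notin> B" for x
      using PiE_mem[OF v, of x] that by simp_all
    have GB: "G (u, v) x = u x + p" if "x \<in> B" for x using that assms(1) by (auto simp: G_def)
    have GA: "G (u, v) x = v x" if "x \<in> A" "x \<notin> B" for x using that by (simp add: G_def)
    have "G (u, v) x \<in> {1..p + k}" if "x \<in> A" for x
      using GA[of x] GB[of x] ub[of x] vb[of x] that by (cases "x \<in> B") simp_all
    then have "G (u, v) \<in> A \<rightarrow>\<^sub>E {1..p + k}" by (auto simp: G_def)
    moreover have "p < G (u, v) x \<longleftrightarrow> x \<in> B" if "x \<in> A" for x
      using GA[of x] GB[of x] ub[of x] vb[of x] that by (cases "x \<in> B") simp_all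
    with assms(1) have "{x\<in>A. p < G (u, v) x} = B" by blast
    moreover have fst: "(\<lambda>x\<in>B. G (u, v) x - p) = u"
      using GB PiE_arb[OF u] by (auto simp: restrict_def fun_eq_iff)
    moreover have snd: "restrict (G (u, v)) (A - B) = v"
      using GA PiE_arb[OF v] by (auto simp: restrict_def fun_eq_iff)
    ultimately show ?thesis using that by (simp add: F_def)
  qed
  have FS: "F g \<in> U \<times> V \<and> G (F g) = g" if "g \<in> ?S" for g
  proof -
    have "x \<in> B \<longleftrightarrow> x \<in> A \<and> p < g x" for x using that by blast
    moreover have "g x = undefined" if "x \<notin> A" for x
      using \<open>g \<in> ?S\<close> that by (auto simp: PiE_def extensional_def)
    ultimately have "G (F g) = g" by (auto simp: G_def F_def fun_eq_iff)
    then show ?thesis using that by (simp add: F_def)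
  qed
  have "bij_betw F ?S (U \<times> V)"
  proof (rule bij_betw_byWitness[where f' = G])
    show "\<forall>g\<in>?S. G (F g) = g" "F ` ?S \<subseteq> U \<times> V" using FS by blast+
    show "\<forall>uv\<in>U \<times> V. F (G uv) = uv" "G ` (U \<times> V) \<subseteq> ?S" using G by blast+
  qed
  then show ?thesis by (simp add: bij_betw_same_card card_cartesian_product)
qed

lemma sum_Pow_card:
  fixes f :: "nat \<Rightarrow> 'b::semiring_1"
  assumes "finite A"
  shows "(\<Sum>B\<in>Pow A. f (card B)) = (\<Sum>k\<le>card A. of_nat (card A choose k) * f k)"
proof -
  have "(\<Sum>B\<in>Pow A. f (card B)) = (\<Sum>k\<le>card A. \<Sum>B | B \<in> Pow A \<and> card B = k. f (card B))"
    using assms by (intro sum.group[symmetric]) (auto intro: card_mono)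
  also have "\<dots> = (\<Sum>k\<le>card A. of_nat (card A choose k) * f k)"
    using assms by (intro sum.cong refl) (simp add: n_subsets)
  finally show ?thesis .
qed

text \<open>This is the binomial theorem for \<open>(y + 1) ^ N\<close> minus its derivative in
  \<open>y\<close>. It carries the induction step of \<open>card_park\<close>.\<close>

lemma binomial_sum_park:
  fixes y :: "'b::comm_ring_1"
  shows "(\<Sum>l\<le>N. of_nat (N choose l) * (y ^ l - of_nat l * y ^ (l - 1)))
    = (y + 1) ^ N - of_nat N * (y + 1) ^ (N - 1)"
proof -
  have "(\<Sum>l\<le>N. of_nat (N choose l) * (of_nat l * y ^ (l - 1))) = of_nat N * (y + 1) ^ (N - 1)"
  proof (cases N)
    case (Suc n)
    have "(\<Sum>l\<le>Suc n. of_nat (Suc n choose l) * (of_nat l * y ^ (l - 1)))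
      = (\<Sum>l\<le>n. of_nat (Suc l * (Suc n choose Suc l)) * y ^ l)"
      by (subst sum.atMost_Suc_shift)
        (simp add: mult_ac del: binomial_Suc_Suc of_nat_Suc of_nat_add mult_Suc mult_Suc_right)
    also have "\<dots> = (\<Sum>l\<le>n. of_nat (Suc n) * (of_nat (n choose l) * y ^ l))"
      by (simp only: Suc_times_binomial of_nat_mult mult.assoc)
    also have "\<dots> = of_nat (Suc n) * (y + 1) ^ n"
      by (simp add: binomial_ring sum_distrib_left)
    finally show ?thesis using Suc by simp
  qed simp
  then show ?thesis
    by (simp add: right_diff_distrib sum_subtractf binomial_ring)
qed

text \<open>For \<open>n = card A\<close> this is \<open>(M - n) * M ^ (n - 1)\<close>, in a form
  that stays correct at \<open>n = 0\<close>. Induction on \<open>M\<close> removes bucket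
  \<open>1\<close>: keys with address \<open>1\<close> are free, and the keys with larger addresses
  must park on the remaining \<open>M\<close> buckets.\<close>

lemma card_park:
  assumes "finite A" "card A \<le> M"
  shows "(of_nat (card (park A M)) :: 'b::comm_ring_1)
    = of_nat M ^ card A - of_nat (card A) * of_nat M ^ (card A - 1)"
  using assms
proof (induction M arbitrary: A)
  case 0
  then show ?case by (simp add: park_def)
next
  case (Suc M)
  show ?case
  proof (cases "card A = Suc M")
    case True
    \<comment> \<open>With \<open>Suc M\<close> keys the bound at \<open>a = 1\<close> fails, and
      the two terms of the formula cancel.\<close>
    have "park A (Suc M) = {}"
    proof (rule ccontr)
      assume "park A (Suc M) \<noteq> {}"
      then obtain g where gp: "g \<in> park A (Suc M)" by blast
      then have g: "g \<in> A \<rightarrow>\<^sub>E {1..Suc M}" by (simp add: park_def)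
      have "card {x\<in>A. 1 \<le> g x} \<le> Suc M - 1" using gp unfolding park_def by fastforce
      moreover have "{x\<in>A. 1 \<le> g x} = A" using PiE_mem[OF g] by auto
      ultimately have "card A \<le> M" by simp
      with g True show False by simp
    qed
    then show ?thesis by (simp only: True card.empty diff_Suc_1 power_Suc) simp
  next
    case False
    with Suc.prems have le: "card A \<le> M" by simp
    \<comment> \<open>\<open>B\<close> is the set of keys with address above \<open>1\<close>. The
      bound \<open>1 + M\<close> and the order of the conditions match \<open>card_split\<close> at
      \<open>p = 1\<close>.\<close>
    define S where "S = (\<lambda>B. {g \<in> A \<rightarrow>\<^sub>E {1..1 + M}. {x\<in>A. 1 < g x} = B \<and>
       (\<lambda>x\<in>B. g x - 1) \<in> park B M \<and> restrict g (A - B) \<in> (A - B) \<rightarrow>\<^sub>E {1..1}})"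
    have mem: "g \<in> park A (Suc M) \<longleftrightarrow> (\<exists>B\<in>Pow A. g \<in> S B)" for g
    proof (cases "g \<in> A \<rightarrow>\<^sub>E {1..1 + M}")
      case True
      define B where "B = {x\<in>A. 1 < g x}"
      have b: "1 \<le> g x" "g x \<le> Suc M" if "x \<in> A" for x
        using True that by (auto simp: PiE_def Pi_def)
      have eq: "{x\<in>B. a \<le> (\<lambda>x\<in>B. g x - 1) x} = {x\<in>A. Suc a \<le> g x}" if "1 \<le> a" for a
        using that by (auto simp: B_def)
      have "(\<lambda>x\<in>B. g x - 1) \<in> B \<rightarrow>\<^sub>E {1..M}"
        using b by (force simp: B_def)
      then have "(\<lambda>x\<in>B. g x - 1) \<in> park B M \<longleftrightarrow> (\<forall>a\<in>{1..M}. card {x\<in>A. Suc a \<le> g x} \<le> M - a)"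
        using eq by (simp add: park_def del: restrict_apply)
      also have "\<dots> \<longleftrightarrow> (\<forall>a\<in>{2..Suc M}. card {x\<in>A. a \<le> g x} \<le> Suc M - a)"
      proof -
        have "{2..Suc M} = Suc ` {1..M}" by (simp add: image_Suc_atLeastAtMost numeral_2_eq_2)
        then show ?thesis by (simp only: ball_simps diff_Suc_Suc)
      qed
      \<comment> \<open>The bound at \<open>a = 1\<close> only says that there are at most
        \<open>M\<close> keys, which is \<open>le\<close>.\<close>
      also have "\<dots> \<longleftrightarrow> (\<forall>a\<in>{1..Suc M}. card {x\<in>A. a \<le> g x} \<le> Suc M - a)"
      proof -
        have "{1..Suc M} = insert 1 {2..Suc M}" by auto
        moreover have "card {x\<in>A. 1 \<le> g x} \<le> Suc M - 1"
          using le card_mono[OF Suc.prems(1), of "{x\<in>A. 1 \<le> g x}"] by (simp add: Collect_subset)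
        ultimately show ?thesis by simp
      qed
      also have "\<dots> \<longleftrightarrow> g \<in> park A (Suc M)" using True by (simp add: park_def)
      finally have iff: "(\<lambda>x\<in>B. g x - 1) \<in> park B M \<longleftrightarrow> g \<in> park A (Suc M)" .
      have "g x \<in> {1..1}" if "x \<in> A - B" for x
        using b[of x] that by (simp add: B_def)
      then have rest: "restrict g (A - B) \<in> (A - B) \<rightarrow>\<^sub>E {1..1}"
        by (simp only: restrict_PiE_iff) blast
      show ?thesis
      proof
        assume "g \<in> park A (Suc M)"
        then have "g \<in> S B" unfolding S_def using True iff rest B_def by (intro CollectI conjI) simp_all
        moreover have "B \<in> Pow A" by (auto simp: B_def)
        ultimately show "\<exists>B\<in>Pow A. g \<in> S B" by (rule rev_bexI[rotated])
      next
        assume "\<exists>B\<in>Pow A. g \<in> S B"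
        then obtain C where "{x\<in>A. 1 < g x} = C" "(\<lambda>x\<in>C. g x - 1) \<in> park C M"
          by (auto simp only: S_def)
        then show "g \<in> park A (Suc M)" using iff by (simp only: B_def)
      qed
    next
      case False
      then show ?thesis unfolding park_def S_def by simp
    qed
    have "park A (Suc M) = (\<Union>B\<in>Pow A. S B)" by (rule set_eqI) (simp only: UN_iff mem)
    then have "card (park A (Suc M)) = card (\<Union>B\<in>Pow A. S B)" by (rule arg_cong)
    also have "\<dots> = (\<Sum>B\<in>Pow A. card (S B))"
    proof (rule card_UN_disjoint)
      show "\<forall>B\<in>Pow A. finite (S B)"
        using finite_PiE[OF Suc.prems(1), of "\<lambda>_. {1..1 + M}"]
        by (intro ballI) (rule finite_subset, auto simp: S_def)
      show "\<forall>B\<in>Pow A. \<forall>C\<in>Pow A. B \<noteq> C \<longrightarrow> S B \<inter> S C = {}" unfolding S_def by blast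
    qed (use Suc.prems(1) in simp)
    also have "\<dots> = (\<Sum>B\<in>Pow A. card (park B M) * card ((A - B) \<rightarrow>\<^sub>E {1..1::nat}))"
      unfolding S_def
    proof (intro sum.cong refl card_split)
      show "B \<subseteq> A" if "B \<in> Pow A" for B using that by simp
      show "park B M \<subseteq> B \<rightarrow>\<^sub>E {1..M}" for B unfolding park_def by (rule Collect_restrict)
    qed simp
    also have "\<dots> = (\<Sum>B\<in>Pow A. card (park B M))"
      using Suc.prems(1) by (intro sum.cong refl) (simp add: card_PiE)
    finally have "(of_nat (card (park A (Suc M))) :: 'b) = (\<Sum>B\<in>Pow A. of_nat (card (park B M)))"
      by simp
    also have "\<dots> = (\<Sum>B\<in>Pow A. of_nat M ^ card B - of_nat (card B) * of_nat M ^ (card B - 1))"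
    proof (rule sum.cong)
      fix B assume "B \<in> Pow A"
      then have "finite B" "card B \<le> M"
        using Suc.prems(1) le card_mono[of A B] by (auto intro: finite_subset)
      then show "(of_nat (card (park B M)) :: 'b) =
        of_nat M ^ card B - of_nat (card B) * of_nat M ^ (card B - 1)" by (rule Suc.IH)
    qed simp
    also have "\<dots> = of_nat (Suc M) ^ card A - of_nat (card A) * of_nat (Suc M) ^ (card A - 1)"
      using Suc.prems(1) by (subst sum_Pow_card) (simp_all only: binomial_sum_park of_nat_Suc add.commute)
    finally show ?thesis .
  qed
qed

subsection \<open>Rotation of tables\<close>

lemma probe_mem: "0 < m \<Longrightarrow> probe m a d \<in> {1..m}"
  by (simp add: probe_def Suc_le_eq)

lemma probe_linear: "1 \<le> a \<Longrightarrow> a + d \<le> m \<Longrightarrow> probe m a d = a + d"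
  by (simp add: probe_def)

lemma probe_steps_notin:
  assumes "a \<in> {1..m}" "b \<in> {1..m}" "b \<notin> B"
  shows "probe m a (probe_steps m B a) \<notin> B"
proof -
  \<comment> \<open>The free bucket \<open>b\<close> is reached after \<open>b + m - a\<close>
    steps, so the \<open>LEAST\<close> in \<open>probe_steps\<close> is attained. Adding
    \<open>m\<close> avoids truncation when \<open>b < a\<close>.\<close>
  have "a - 1 + (b + m - a) = b - 1 + m" using assms by auto
  then have "probe m a (b + m - a) = (b - 1) mod m + 1" by (simp only: probe_def mod_add_self2)
  also have "\<dots> = b" using assms(2) by auto
  finally have "probe m a (b + m - a) = b" .
  with assms(3) have "probe m a (b + m - a) \<notin> B" by simp
  then show ?thesis
    unfolding probe_steps_def by (rule LeastI)
qed

text \<open>An empty bucket \<open>m\<close> stops every probe at the latest, so probing never wraps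
  around and \<open>mod\<close> disappears.\<close>

lemma linear_landing:
  assumes "m \<notin> B" "a \<in> {1..m}"
  defines "d \<equiv> probe_steps m B a"
  shows "a + d \<le> m" "probe m a d = a + d" "{a..<a + d} \<subseteq> B" "a + d \<notin> B"
proof -
  have "d \<le> m - a"
    unfolding d_def probe_steps_def using assms by (intro Least_le) (simp add: probe_linear)
  with assms(2) show le: "a + d \<le> m" by auto
  with assms show eq: "probe m a d = a + d" by (simp add: probe_linear)
  show "{a..<a + d} \<subseteq> B"
  proof
    fix y assume y: "y \<in> {a..<a + d}"
    then have "y - a < d" by auto
    then have "probe m a (y - a) \<in> B"
      using not_less_Least unfolding d_def probe_steps_def by blast
    with y le assms show "y \<in> B" by (simp add: probe_linear)
  qed
  show "a + d \<notin> B"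
    using probe_steps_notin[OF assms(2) _ assms(1)] assms(2) eq by (auto simp: d_def)
qed

lemma occupied_eq_bucket: "occupied m h n = bucket m h ` {1..n}"
  by (induction n) (auto simp: bucket_def displacement_def atLeastAtMostSuc_conv)

lemma occupied_mono: "k \<le> n \<Longrightarrow> occupied m h k \<subseteq> occupied m h n"
  unfolding occupied_eq_bucket by auto

lemma occupied_cong:
  "(\<And>x. x \<in> {1..n} \<Longrightarrow> h x = h' x) \<Longrightarrow> occupied m h n = occupied m h' n"
  by (induction n) simp_all

lemma displacement_cong:
  assumes "\<And>x. x \<in> {1..n} \<Longrightarrow> h x = h' x" "1 \<le> n"
  shows "displacement m h n = displacement m h' n"
proof -
  have "occupied m h (n - 1) = occupied m h' (n - 1)"
    by (rule occupied_cong, rule assms(1)) auto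
  moreover have "h n = h' n" using assms(2) by (intro assms(1)) simp
  ultimately show ?thesis by (simp only: displacement_def)
qed

lemma bucket_cong:
  assumes "\<And>x. x \<in> {1..n} \<Longrightarrow> h x = h' x" "1 \<le> n"
  shows "bucket m h n = bucket m h' n"
proof -
  have "h n = h' n" using assms(2) by (intro assms(1)) simp
  moreover have "displacement m h n = displacement m h' n" by (rule displacement_cong[OF assms(1) assms(2)])
  ultimately show ?thesis by (simp only: bucket_def)
qed

lemma occupied_subset: "0 < m \<Longrightarrow> occupied m h n \<subseteq> {1..m}"
  unfolding occupied_eq_bucket bucket_def by (auto simp: probe_def Suc_le_eq)

section \<open>The cyclic shift by one bucket as a symmetry of insertion\<close>

definition rot :: "nat \<Rightarrow> nat \<Rightarrow> nat" where
  "rot m b = b mod m + 1"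

lemma probe_rot:
  assumes "0 < m" "1 \<le> a"
  shows "probe m (rot m a) d = rot m (probe m a d)"
proof -
  have "(a mod m + d) mod m = ((a - 1 + d) mod m + 1) mod m"
    using assms by (simp add: mod_simps)
  then show ?thesis by (simp add: probe_def rot_def)
qed

lemma bij_rot: 
  assumes "0 < m" shows "bij_betw (rot m) {1..m} {1..m}"
proof -
  have "inj_on (rot m) {1..m}"
  proof
    fix a b assume ab: "a \<in> {1..m}" "b \<in> {1..m}" "rot m a = rot m b"
    then show "a = b" by (cases "a = m"; cases "b = m") (auto simp: rot_def)
  qed
  moreover have "rot m ` {1..m} \<subseteq> {1..m}" using assms by (auto simp: rot_def Suc_le_eq)
  ultimately show ?thesis by (auto simp: bij_betw_def endo_inj_surj)
qed

lemma probe_steps_rot: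
  assumes "0 < m" "1 \<le> a" "B \<subseteq> {1..m}"
  shows "probe_steps m (rot m ` B) (rot m a) = probe_steps m B a"
proof -
  have "probe m (rot m a) d \<in> rot m ` B \<longleftrightarrow> probe m a d \<in> B" for d
    unfolding probe_rot[OF assms(1,2)]
    using bij_rot[OF assms(1)] probe_mem[OF assms(1)] assms(3)
    by (intro inj_on_image_mem_iff) (auto simp: bij_betw_def)
  then show ?thesis by (simp add: probe_steps_def)
qed

lemma occupied_rot:
  assumes "0 < m" "\<And>x. x \<in> {1..n} \<Longrightarrow> 1 \<le> h x"
  shows "occupied m (rot m \<circ> h) n = rot m ` occupied m h n"
  using assms(2)
  by (induction n)
    (simp_all add: probe_steps_rot[OF assms(1) _ occupied_subset[OF assms(1)]] probe_rot[OF assms(1)])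

lemma displacement_rot:
  assumes "0 < m" "1 \<le> n" "\<And>x. x \<in> {1..n} \<Longrightarrow> 1 \<le> h x"
  shows "displacement m (rot m \<circ> h) n = displacement m h n"
proof -
  have "occupied m (rot m \<circ> h) (n - 1) = rot m ` occupied m h (n - 1)"
    using assms(2) by (intro occupied_rot assms(1,3)) auto
  moreover have "1 \<le> h n" using assms(2) by (intro assms(3)) simp
  ultimately show ?thesis
    by (simp add: displacement_def probe_steps_rot[OF assms(1) _ occupied_subset[OF assms(1)]])
qed

lemma bucket_rot:
  assumes "0 < m" "1 \<le> n" "\<And>x. x \<in> {1..n} \<Longrightarrow> 1 \<le> h x"
  shows "bucket m (rot m \<circ> h) n = rot m (bucket m h n)"
proof -
  have "1 \<le> h n" using assms(2) by (intro assms(3)) simp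
  then show ?thesis
    using displacement_rot[OF assms] by (simp add: bucket_def probe_rot[OF assms(1)])
qed

text \<open>Rotation permutes the address functions, preserves \<open>f\<close> and moves the bucket
  of key \<open>n\<close> one place on. Hence each of the \<open>m\<close> possible buckets of key
  \<open>n\<close> contributes the same sum.\<close>

lemma sum_by_last_bucket:
  fixes f :: "(nat \<Rightarrow> nat) \<Rightarrow> 'b::comm_semiring_1"
  assumes m: "0 < m" and n: "1 \<le> n"
    and inv: "\<And>h. h \<in> {1..n} \<rightarrow>\<^sub>E {1..m} \<Longrightarrow> f (restrict (rot m \<circ> h) {1..n}) = f h"
  shows "(\<Sum>h\<in>{1..n} \<rightarrow>\<^sub>E {1..m}. f h)
    = of_nat m * (\<Sum>h | h \<in> {1..n} \<rightarrow>\<^sub>E {1..m} \<and> bucket m h n = m. f h)"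
proof -
  define S where "S = {1..n} \<rightarrow>\<^sub>E {1..m}"
  \<comment> \<open>Restricting returns the rotated addresses to the extensional functions, so that
    \<open>R\<close> permutes \<open>S\<close>.\<close>
  define R where "R = (\<lambda>h. restrict (rot m \<circ> h) {1..n})"
  define V where "V = (\<lambda>c. \<Sum>h | h \<in> S \<and> bucket m h n = c. f h)"
  have fin: "finite S" by (simp add: S_def finite_PiE)
  have mem: "h x \<in> {1..m}" if "h \<in> S" "x \<in> {1..n}" for h x
    using that unfolding S_def by (rule PiE_mem)
  have "R h \<in> S" if "h \<in> S" for h
    unfolding R_def S_def using bij_betw_apply[OF bij_rot[OF m] mem[OF that]]
    by (simp add: restrict_PiE_iff)
  then have RS: "R ` S \<subseteq> S" by blast
  have "inj_on R S"
  proof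
    fix g h assume gh: "g \<in> S" "h \<in> S" "R g = R h"
    show "g = h"
    proof (rule PiE_ext)
      show "g \<in> {1..n} \<rightarrow>\<^sub>E {1..m}" "h \<in> {1..n} \<rightarrow>\<^sub>E {1..m}" using gh by (simp_all add: S_def)
      fix x assume x: "x \<in> {1..n}"
      then have "rot m (g x) = rot m (h x)" using fun_cong[OF gh(3), of x] by (simp add: R_def)
      then show "g x = h x" 
        using gh(1,2) mem x bij_rot[OF m] by (auto simp: bij_betw_def dest!: inj_onD)
    qed
  qed
  then have bij: "bij_betw R S S" using RS fin by (auto simp: bij_betw_def endo_inj_surj)
  have buc: "bucket m (R h) n = rot m (bucket m h n)" if "h \<in> S" for h
  proof -
    have "bucket m (R h) n = bucket m (rot m \<circ> h) n"
      using n by (intro bucket_cong) (auto simp: R_def)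
    also have "\<dots> = rot m (bucket m h n)" using m n mem[OF that] by (intro bucket_rot) auto
    finally show ?thesis .
  qed
  have bucm: "bucket m h n \<in> {1..m}" for h using m unfolding bucket_def by (rule probe_mem)
  have V_rot: "V (rot m c) = V c" if c: "c \<in> {1..m}" for c
  proof -
    have eq: "bucket m (R h) n = rot m c \<longleftrightarrow> bucket m h n = c" if "h \<in> S" for h
      using buc[OF that] c bucm bij_rot[OF m] by (metis bij_betw_def inj_onD)
    have "R ` {h \<in> S. bucket m h n = c} = {h \<in> R ` S. bucket m h n = rot m c}"
      using eq by (auto simp only: image_iff mem_Collect_eq)
    also have "R ` S = S" using bij by (simp add: bij_betw_def)
    finally have "bij_betw R {h \<in> S. bucket m h n = c} {h \<in> S. bucket m h n = rot m c}"
      by (intro bij_betw_subset[OF bij]) simp_all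
    then have "V (rot m c) = (\<Sum>h | h \<in> S \<and> bucket m h n = c. f (R h))"
      unfolding V_def by (rule sum.reindex_bij_betw[symmetric])
    also have "\<dots> = V c" using inv by (auto simp: V_def S_def R_def intro!: sum.cong)
    finally show ?thesis .
  qed
  have V1: "c < m \<Longrightarrow> V (Suc c) = V 1" for c
  proof (induction c)
    case (Suc c)
    then show ?case using V_rot[of "Suc c"] by (simp add: rot_def)
  qed simp
  have Vm: "V c = V m" if "c \<in> {1..m}" for c
    using V1[of "c - 1"] V1[of "m - 1"] that m by auto
  have "sum f S = (\<Sum>c\<in>{1..m}. V c)"
    unfolding V_def using fin bucm by (intro sum.group[symmetric]) auto
  also have "\<dots> = (\<Sum>c\<in>{1..m}. V m)" by (rule sum.cong[OF refl Vm])
  finally show ?thesis by (simp add: V_def S_def)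
qed

lemma sum_PiE_Suc:
  "(\<Sum>h\<in>{1..Suc n} \<rightarrow>\<^sub>E C. F h) = (\<Sum>g\<in>{1..n} \<rightarrow>\<^sub>E C. \<Sum>a\<in>C. F (g(Suc n := a)))"
proof -
  have "(\<Sum>h\<in>{1..Suc n} \<rightarrow>\<^sub>E C. F h)
     = (\<Sum>(a, g)\<in>C \<times> ({1..n} \<rightarrow>\<^sub>E C). F (g(Suc n := a)))"
    unfolding atLeastAtMostSuc_conv[of 1 n, OF le_add1[of 1 n, unfolded plus_1_eq_Suc]] PiE_insert_eq
    by (subst sum.reindex) (auto simp: case_prod_unfold intro!: inj_combinator[simplified])
  also have "\<dots> = (\<Sum>a\<in>C. \<Sum>g\<in>{1..n} \<rightarrow>\<^sub>E C. F (g(Suc n := a)))"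
    by (rule sum.cartesian_product[symmetric])
  also have "\<dots> = (\<Sum>g\<in>{1..n} \<rightarrow>\<^sub>E C. \<Sum>a\<in>C. F (g(Suc n := a)))"
    by (rule sum.swap)
  finally show ?thesis .
qed

subsection \<open>Occupied buckets\<close>

text \<open>Bucket \<open>m\<close> has to be empty only after \<open>n - 1\<close> keys: then each
  of the first \<open>n\<close> keys still finds it empty on arrival. Key \<open>n\<close> itself
  may fill it, which \<open>last_notin_occupied_iff\<close> exploits.\<close>

lemma bucket_linear:
  assumes "m \<notin> occupied m h (n - 1)" "x \<in> {1..n}" "h x \<in> {1..m}"
  shows "h x \<le> bucket m h x" "bucket m h x \<le> m"
    "{h x..<bucket m h x} \<subseteq> occupied m h (x - 1)" "bucket m h x \<notin> occupied m h (x - 1)"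
proof -
  have "occupied m h (x - 1) \<subseteq> occupied m h (n - 1)"
    using assms(2) by (intro occupied_mono) auto
  with assms(1) have "m \<notin> occupied m h (x - 1)" by blast
  from linear_landing[OF this assms(3)]
  show "h x \<le> bucket m h x" "bucket m h x \<le> m"
    "{h x..<bucket m h x} \<subseteq> occupied m h (x - 1)" "bucket m h x \<notin> occupied m h (x - 1)"
    by (simp_all add: bucket_def displacement_def)
qed

text \<open>A key passes only over occupied buckets, so none of the \<open>n\<close> keys passes
  over a bucket that is still empty after all of them.\<close>

lemma bucket_crosses_iff:
  assumes "m \<notin> occupied m h (n - 1)" "x \<in> {1..n}" "h x \<in> {1..m}" "b \<notin> occupied m h n"
  shows "b < bucket m h x \<longleftrightarrow> b < h x"
proof -
  have "occupied m h (x - 1) \<subseteq> occupied m h n"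
    using assms(2) by (intro occupied_mono) auto
  with bucket_linear(3)[OF assms(1-3)] assms(4) have "b \<notin> {h x..<bucket m h x}" by blast
  then show ?thesis using bucket_linear(1)[OF assms(1-3)] by auto
qed

text \<open>Each key lands in a bucket that was empty before it, so \<open>bucket m h\<close> is
  injective on the keys and counting keys amounts to counting buckets.\<close>

lemma card_bucket_in:
  assumes "m \<notin> occupied m h (n - 1)" "\<And>x. x \<in> {1..n} \<Longrightarrow> h x \<in> {1..m}"
  shows "card {x\<in>{1..n}. bucket m h x \<in> I} = card (occupied m h n \<inter> I)"
proof -
  have less: "bucket m h x \<noteq> bucket m h y" if "x < y" "x \<in> {1..n}" "y \<in> {1..n}" for x y
  proof -
    have "bucket m h x \<in> occupied m h (y - 1)"
      using that unfolding occupied_eq_bucket by (intro imageI) auto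
    with bucket_linear(4)[OF assms(1) that(3) assms(2)[OF that(3)]] show ?thesis by auto
  qed
  have "inj_on (bucket m h) {1..n}"
  proof
    fix x y assume "x \<in> {1..n}" "y \<in> {1..n}" "bucket m h x = bucket m h y"
    then show "x = y" using less[of x y] less[of y x] by (cases x y rule: linorder_cases) auto
  qed
  then have "card {x\<in>{1..n}. bucket m h x \<in> I} = card (bucket m h ` {x\<in>{1..n}. bucket m h x \<in> I})"
    by (intro card_image[symmetric]) (auto intro: inj_on_subset)
  also have "bucket m h ` {x\<in>{1..n}. bucket m h x \<in> I} = occupied m h n \<inter> I"
    unfolding occupied_eq_bucket by blast
  finally show ?thesis .
qed

text \<open>The inserted \<open>0\<close> acts as an empty bucket in front of bucket
  \<open>1\<close>; it is the value when \<open>{1..<b}\<close> is full.\<close>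

definition last_empty :: "nat \<Rightarrow> nat set \<Rightarrow> nat" where
  "last_empty b B = Max (insert 0 ({1..<b} - B))"

lemma last_empty_iff:
  assumes "0 < b"
  shows "last_empty b B = p \<longleftrightarrow> p < b \<and> (p = 0 \<or> p \<notin> B) \<and> {p<..<b} \<subseteq> B"
proof -
  have "last_empty b B = p \<longleftrightarrow>
      p \<in> insert 0 ({1..<b} - B) \<and> (\<forall>c\<in>insert 0 ({1..<b} - B). c \<le> p)"
    unfolding last_empty_def by (rule Max_eq_iff) auto
  also have "\<dots> \<longleftrightarrow> p < b \<and> (p = 0 \<or> p \<notin> B) \<and> (\<forall>c\<in>{1..<b} - B. c \<le> p)"
    using assms by auto
  also have "(\<forall>c\<in>{1..<b} - B. c \<le> p) \<longleftrightarrow> {p<..<b} \<subseteq> B"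
  proof
    assume le: "\<forall>c\<in>{1..<b} - B. c \<le> p"
    show "{p<..<b} \<subseteq> B"
    proof
      fix c assume c: "c \<in> {p<..<b}"
      then show "c \<in> B" using bspec[OF le, of c] by fastforce
    qed
  qed (auto simp: not_less[symmetric])
  finally show ?thesis .
qed

text \<open>A pigeonhole criterion on the addresses alone. If \<open>b\<close> is occupied, the
  buckets after the last empty one up to \<open>b\<close> are filled by keys addressed there. If
  \<open>b\<close> is empty, the keys addressed to \<open>{a..b}\<close> all land in
  \<open>{a..<b}\<close>, so there are at most \<open>b - a\<close> of them.\<close>

lemma occupied_iff:
  assumes lin: "m \<notin> occupied m h (n - 1)" and h: "\<And>x. x \<in> {1..n} \<Longrightarrow> h x \<in> {1..m}"
    and b: "b \<in> {1..m}"
  shows "b \<in> occupied m h n \<longleftrightarrow> (\<exists>a\<in>{1..b}. b - a < card {x\<in>{1..n}. h x \<in> {a..b}})"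
proof
  assume bo: "b \<in> occupied m h n"
  define p where "p = last_empty b (occupied m h n)"
  have p: "p < b" "p = 0 \<or> p \<notin> occupied m h n" "{p<..<b} \<subseteq> occupied m h n"
    using last_empty_iff[of b "occupied m h n" p] b by (auto simp: p_def)
  have "0 \<notin> occupied m h n" using occupied_subset[of m h n] b by auto
  with p(2) have p0: "p \<notin> occupied m h n" by auto
  have "{Suc p..b} \<subseteq> occupied m h n"
  proof
    fix y assume "y \<in> {Suc p..b}"
    then show "y \<in> occupied m h n" using bo p(3) by (cases "y = b") auto
  qed
  then have "card {Suc p..b} = card {x\<in>{1..n}. bucket m h x \<in> {Suc p..b}}"
    by (subst card_bucket_in[OF lin h]) (simp_all add: Int_absorb1)
  also have "\<dots> \<le> card {x\<in>{1..n}. h x \<in> {Suc p..b}}"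
  proof (intro card_mono)
    have "h x \<in> {Suc p..b}" if "x \<in> {1..n}" "bucket m h x \<in> {Suc p..b}" for x
      using bucket_linear(1)[OF lin that(1) h] bucket_crosses_iff[OF lin that(1) h p0] that by auto
    then show "{x\<in>{1..n}. bucket m h x \<in> {Suc p..b}} \<subseteq> {x\<in>{1..n}. h x \<in> {Suc p..b}}" by blast
  qed simp
  finally show "\<exists>a\<in>{1..b}. b - a < card {x\<in>{1..n}. h x \<in> {a..b}}"
    using p(1) by (intro bexI[of _ "Suc p"]) auto
next
  assume "\<exists>a\<in>{1..b}. b - a < card {x\<in>{1..n}. h x \<in> {a..b}}"
  then obtain a where a: "b - a < card {x\<in>{1..n}. h x \<in> {a..b}}" by blast
  show "b \<in> occupied m h n"
  proof (rule ccontr)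
    assume nb: "b \<notin> occupied m h n"
    have "card {x\<in>{1..n}. h x \<in> {a..b}} \<le> card {x\<in>{1..n}. bucket m h x \<in> {a..<b}}"
    proof (intro card_mono)
      have "bucket m h x \<in> {a..<b}" if "x \<in> {1..n}" "h x \<in> {a..b}" for x
      proof -
        have "bucket m h x \<noteq> b" using nb that by (auto simp: occupied_eq_bucket)
        then show ?thesis
          using bucket_linear(1)[OF lin that(1) h] bucket_crosses_iff[OF lin that(1) h nb] that
          by auto
      qed
      then show "{x\<in>{1..n}. h x \<in> {a..b}} \<subseteq> {x\<in>{1..n}. bucket m h x \<in> {a..<b}}" by blast
    qed simp
    also have "\<dots> \<le> card {a..<b}"
      by (subst card_bucket_in[OF lin h]) (simp, rule card_mono, auto)
    finally show False using a by simp
  qed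
qed

text \<open>This justifies the bounds in \<open>park\<close>. Since \<open>occupied_iff\<close>
  wants bucket \<open>m\<close> empty before the last key, the proof adds keys one at a time: once
  \<open>m\<close> is filled, some bound is broken, and it stays broken because the counts only
  grow.\<close>

lemma last_notin_occupied_iff:
  assumes "0 < m" "\<And>x. x \<in> {1..n} \<Longrightarrow> h x \<in> {1..m}"
  shows "m \<notin> occupied m h n \<longleftrightarrow> (\<forall>a\<in>{1..m}. card {x\<in>{1..n}. a \<le> h x} \<le> m - a)"
  using assms(2)
proof (induction n)
  case (Suc n)
  have eq: "{x\<in>{1..Suc n}. h x \<in> {a..m}} = {x\<in>{1..Suc n}. a \<le> h x}" for a
    using Suc.prems by auto
  have step: "m \<notin> occupied m h (Suc n) \<longleftrightarrow> (\<forall>a\<in>{1..m}. card {x\<in>{1..Suc n}. a \<le> h x} \<le> m - a)"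
    if "m \<notin> occupied m h n"
  proof -
    have "m \<in> occupied m h (Suc n) \<longleftrightarrow> (\<exists>a\<in>{1..m}. m - a < card {x\<in>{1..Suc n}. h x \<in> {a..m}})"
      using that assms(1) Suc.prems by (intro occupied_iff) simp_all
    then show ?thesis unfolding eq by (meson not_less)
  qed
  show ?case
  proof (cases "m \<in> occupied m h n")
    case True
    moreover have "m \<notin> occupied m h n \<longleftrightarrow> (\<forall>a\<in>{1..m}. card {x\<in>{1..n}. a \<le> h x} \<le> m - a)"
      by (rule Suc.IH) (rule Suc.prems, simp)
    ultimately obtain a where a: "a \<in> {1..m}" "\<not> card {x\<in>{1..n}. a \<le> h x} \<le> m - a"
      by blast
    have "card {x\<in>{1..n}. a \<le> h x} \<le> card {x\<in>{1..Suc n}. a \<le> h x}"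
      by (intro card_mono) auto
    then have "\<not> card {x\<in>{1..Suc n}. a \<le> h x} \<le> m - a" using a(2) by linarith
    moreover have "m \<in> occupied m h (Suc n)" using True by simp
    ultimately show ?thesis using a(1) by metis
  next
    case False
    then show ?thesis by (rule step)
  qed
qed simp

text \<open>The three conditions say in turn that \<open>m\<close> is empty, that \<open>p\<close>
  is empty (vacuous for \<open>p = 0\<close>), and that the buckets between them are full. For the
  last one, no key crosses the empty bucket \<open>p\<close>, so the keys addressed above
  \<open>p\<close> are exactly those landing there.\<close>

lemma last_empty_occupied_iff:
  assumes g: "\<And>x. x \<in> {1..n} \<Longrightarrow> g x \<in> {1..m}" and p: "p < m"
  shows "m \<notin> occupied m g n \<and> last_empty m (occupied m g n) = p \<longleftrightarrow>
    (\<forall>a\<in>{1..m}. card {x\<in>{1..n}. a \<le> g x} \<le> m - a) \<and>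
    (\<forall>a\<in>{1..p}. card {x\<in>{1..n}. g x \<in> {a..p}} \<le> p - a) \<and>
    card {x\<in>{1..n}. p < g x} = m - 1 - p" (is "_ \<longleftrightarrow> ?M \<and> ?P \<and> ?C")
proof (cases "m \<in> occupied m g n")
  case True
  moreover have "\<not> ?M" using last_notin_occupied_iff[of m n g] g p True by blast
  ultimately show ?thesis by blast
next
  case False
  let ?O = "occupied m g n"
  have M: ?M using last_notin_occupied_iff[of m n g] g p False by blast
  have lin: "m \<notin> occupied m g (n - 1)" using False occupied_mono[of "n - 1" n m g] by auto
  have P: "(p = 0 \<or> p \<notin> ?O) \<longleftrightarrow> ?P"
  proof (cases "p = 0")
    case False
    then have "p \<in> {1..m}" using p by simp
    from occupied_iff[OF lin g this] False show ?thesis by (meson not_less)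
  qed simp
  have C: "{p<..<m} \<subseteq> ?O \<longleftrightarrow> ?C" if p0: "p = 0 \<or> p \<notin> ?O"
  proof -
    have "0 \<notin> ?O" using occupied_subset[of m g n] p by auto
    with p0 have np: "p \<notin> ?O" by auto
    have "p < g x \<longleftrightarrow> bucket m g x \<in> {p<..m}" if "x \<in> {1..n}" for x
      using bucket_crosses_iff[OF lin that g np] bucket_linear(2)[OF lin that g] that by simp
    then have "{x\<in>{1..n}. p < g x} = {x\<in>{1..n}. bucket m g x \<in> {p<..m}}" by blast
    then have "card {x\<in>{1..n}. p < g x} = card (?O \<inter> {p<..m})"
      using card_bucket_in[OF lin g] by (simp only:)
    also have "?O \<inter> {p<..m} = {p<..<m} \<inter> ?O"
      using \<open>m \<notin> ?O\<close> by (auto simp: order.order_iff_strict)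
    finally have card: "card {x\<in>{1..n}. p < g x} = card ({p<..<m} \<inter> ?O)" .
    have "{p<..<m} \<subseteq> ?O \<longleftrightarrow> card ({p<..<m} \<inter> ?O) = card {p<..<m}"
      using card_subset_eq[of "{p<..<m}" "{p<..<m} \<inter> ?O"] by (auto simp: Int_absorb2)
    then show ?thesis unfolding card by simp
  qed
  have "last_empty m ?O = p \<longleftrightarrow> (p = 0 \<or> p \<notin> ?O) \<and> {p<..<m} \<subseteq> ?O"
    using last_empty_iff[of m ?O p] p by simp
  also have "\<dots> \<longleftrightarrow> ?P \<and> ?C" using P C by (intro conj_cong) simp_all
  finally show ?thesis using False M by simp
qed

section \<open>Splitting a parking problem at the last empty bucket\<close>

text \<open>Bounds above \<open>p\<close> are those of \<open>park B k\<close>, shifted. Bounds at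
  \<open>a \<le> p\<close> follow from the lower piece, since at most \<open>p - a\<close> keys of
  \<open>{a..p}\<close> and the \<open>k - 1\<close> keys of \<open>B\<close> add up to less than
  \<open>p + k - a\<close>.\<close>

lemma park_pieces_iff:
  assumes g: "g \<in> A \<rightarrow>\<^sub>E {1..p + k}" and k: "0 < k" and fin: "finite A"
  defines "B \<equiv> {x\<in>A. p < g x}"
  shows "(\<forall>a\<in>{1..p + k}. card {x\<in>A. a \<le> g x} \<le> p + k - a) \<and>
      (\<forall>a\<in>{1..p}. card {x\<in>A. g x \<in> {a..p}} \<le> p - a) \<and> card B = k - 1 \<longleftrightarrow>
    (\<lambda>x\<in>B. g x - p) \<in> park B k \<and> restrict g (A - B) \<in> park (A - B) p \<and> card B = k - 1"
    (is "?M \<and> ?P \<and> _ \<longleftrightarrow> _")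
proof -
  have gx: "g x \<in> {1..p + k}" if "x \<in> A" for x using PiE_mem[OF g that] .
  have "restrict g (A - B) \<in> (A - B) \<rightarrow>\<^sub>E {1..p}"
    unfolding restrict_PiE_iff using gx by (auto simp: B_def)
  moreover have "{x\<in>A - B. a \<le> restrict g (A - B) x} = {x\<in>A. g x \<in> {a..p}}" for a
    by (auto simp: B_def)
  ultimately have P: "restrict g (A - B) \<in> park (A - B) p \<longleftrightarrow> ?P"
    unfolding park_def by simp
  have "g x - p \<in> {1..k}" if "x \<in> B" for x
    using gx[of x] that by (auto simp: B_def)
  then have "(\<lambda>x\<in>B. g x - p) \<in> B \<rightarrow>\<^sub>E {1..k}"
    by (simp only: restrict_PiE_iff) blast
  moreover have "{x\<in>B. a \<le> (\<lambda>x\<in>B. g x - p) x} = {x\<in>A. p + a \<le> g x}" if "a \<in> {1..k}" for a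
    using that by (auto simp: B_def)
  ultimately have K: "(\<lambda>x\<in>B. g x - p) \<in> park B k \<longleftrightarrow>
      (\<forall>a\<in>{1..k}. card {x\<in>A. p + a \<le> g x} \<le> k - a)"
    unfolding park_def by simp
  have "?M \<longleftrightarrow> (\<forall>a\<in>{1..k}. card {x\<in>A. p + a \<le> g x} \<le> k - a)" if P: ?P and C: "card B = k - 1"
  proof
    assume M: ?M
    show "\<forall>a\<in>{1..k}. card {x\<in>A. p + a \<le> g x} \<le> k - a"
    proof
      fix a assume "a \<in> {1..k}"
      then have "p + a \<in> {1..p + k}" by simp
      from bspec[OF M this] show "card {x\<in>A. p + a \<le> g x} \<le> k - a" by simp
    qed
  next
    assume K: "\<forall>a\<in>{1..k}. card {x\<in>A. p + a \<le> g x} \<le> k - a"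
    show ?M
    proof
      fix a assume a: "a \<in> {1..p + k}"
      show "card {x\<in>A. a \<le> g x} \<le> p + k - a"
      proof (cases "a \<le> p")
        case True
        then have "{x\<in>A. a \<le> g x} = {x\<in>A. g x \<in> {a..p}} \<union> B" by (auto simp: B_def)
        then have "card {x\<in>A. a \<le> g x} \<le> card {x\<in>A. g x \<in> {a..p}} + card B"
          using card_Un_le by simp
        moreover have "card {x\<in>A. g x \<in> {a..p}} \<le> p - a" using bspec[OF P, of a] a True by simp
        ultimately show ?thesis using C k True by linarith
      next
        case False
        then have "a - p \<in> {1..k}" "p + (a - p) = a" "k - (a - p) = p + k - a" using a by auto
        with bspec[OF K this(1)] show ?thesis by (simp only:)
      qed
    qed
  qed
  with P K show ?thesis by blast
qed

lemma card_park_pieces: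
  assumes "finite A"
  shows "card {g \<in> A \<rightarrow>\<^sub>E {1..p + k}. (\<lambda>x\<in>{x\<in>A. p < g x}. g x - p) \<in> park {x\<in>A. p < g x} k \<and>
      restrict g (A - {x\<in>A. p < g x}) \<in> park (A - {x\<in>A. p < g x}) p \<and> card {x\<in>A. p < g x} = c}
    = (\<Sum>B | B \<subseteq> A \<and> card B = c. card (park B k) * card (park (A - B) p))" (is "card ?X = _")
proof -
  define S where "S = (\<lambda>B. {g \<in> A \<rightarrow>\<^sub>E {1..p + k}. {x\<in>A. p < g x} = B \<and>
      (\<lambda>x\<in>B. g x - p) \<in> park B k \<and> restrict g (A - B) \<in> park (A - B) p})"
  let ?I = "{B. B \<subseteq> A \<and> card B = c}"
  have "g \<in> ?X \<longleftrightarrow> (\<exists>B\<in>?I. g \<in> S B)" for g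
  proof
    assume "g \<in> ?X"
    then show "\<exists>B\<in>?I. g \<in> S B"
      unfolding S_def by (intro bexI[of _ "{x\<in>A. p < g x}"]) auto
  next
    assume "\<exists>B\<in>?I. g \<in> S B"
    then obtain B where "g \<in> S B" "card B = c" by blast
    then show "g \<in> ?X" unfolding S_def by (auto simp only: mem_Collect_eq)
  qed
  then have "?X = (\<Union>B\<in>?I. S B)" by (intro set_eqI) (simp only: UN_iff)
  then have "card ?X = card (\<Union>B\<in>?I. S B)" by (rule arg_cong)
  also have "\<dots> = (\<Sum>B\<in>?I. card (S B))"
  proof (rule card_UN_disjoint)
    show "\<forall>B\<in>?I. finite (S B)"
      using finite_PiE[OF assms, of "\<lambda>_. {1..p + k}"]
      by (intro ballI) (rule finite_subset, auto simp: S_def)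
    show "\<forall>B\<in>?I. \<forall>C\<in>?I. B \<noteq> C \<longrightarrow> S B \<inter> S C = {}" unfolding S_def by blast
    show "finite ?I" using assms by simp
  qed
  also have "\<dots> = (\<Sum>B\<in>?I. card (park B k) * card (park (A - B) p))"
    unfolding S_def
  proof (intro sum.cong refl card_split)
    show "B \<subseteq> A" if "B \<in> ?I" for B using that by simp
    show "park B k \<subseteq> B \<rightarrow>\<^sub>E {1..k}" for B unfolding park_def by (rule Collect_restrict)
    show "park (A - B) p \<subseteq> (A - B) \<rightarrow>\<^sub>E {1..p}" for B unfolding park_def by (rule Collect_restrict)
  qed
  finally show ?thesis .
qed

text \<open>Choose the \<open>k - 1\<close> keys addressed above \<open>p\<close>; they park on
  \<open>k\<close> buckets, and the other \<open>r\<close> keys park on \<open>p\<close> buckets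
  with \<open>p\<close> left empty. If \<open>k - 1\<close> exceeds \<open>n\<close>, the binomial
  coefficient is \<open>0\<close>.\<close>

lemma card_last_empty:
  assumes n: "n < p + k" and k: "0 < k"
  defines "r \<equiv> n - (k - 1)"
  shows "(of_nat (card {g \<in> {1..n} \<rightarrow>\<^sub>E {1..p + k}.
       p + k \<notin> occupied (p + k) g n \<and> last_empty (p + k) (occupied (p + k) g n) = p}) :: 'b::comm_ring_1)
    = of_nat (n choose (k - 1)) * of_nat k ^ (k - 2) * (of_nat p ^ r - of_nat r * of_nat p ^ (r - 1))"
    (is "of_nat (card ?X) = ?R")
proof -
  let ?A = "{1..n}" and ?B = "\<lambda>g. {x\<in>{1..n}. p < g x}"
  have "?X = {g \<in> ?A \<rightarrow>\<^sub>E {1..p + k}. (\<lambda>x\<in>?B g. g x - p) \<in> park (?B g) k \<and>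
      restrict g (?A - ?B g) \<in> park (?A - ?B g) p \<and> card (?B g) = k - 1}" (is "_ = ?Y")
  proof (rule Collect_cong, rule conj_cong[OF refl])
    fix g assume g: "g \<in> ?A \<rightarrow>\<^sub>E {1..p + k}"
    have "p < p + k" "p + k - 1 - p = k - 1" using k by simp_all
    from last_empty_occupied_iff[OF PiE_mem[OF g] this(1)] this(2) park_pieces_iff[OF g k]
    show "p + k \<notin> occupied (p + k) g n \<and> last_empty (p + k) (occupied (p + k) g n) = p \<longleftrightarrow>
      (\<lambda>x\<in>?B g. g x - p) \<in> park (?B g) k \<and>
      restrict g (?A - ?B g) \<in> park (?A - ?B g) p \<and> card (?B g) = k - 1"
      by (simp only: finite_atLeastAtMost simp_thms)
  qed
  then have "card ?X = card ?Y" by (rule arg_cong)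
  also have "\<dots> = (\<Sum>B | B \<subseteq> ?A \<and> card B = k - 1. card (park B k) * card (park (?A - B) p))"
    by (rule card_park_pieces) simp
  finally have "(of_nat (card ?X) :: 'b) =
      (\<Sum>B | B \<subseteq> ?A \<and> card B = k - 1. of_nat (card (park B k)) * of_nat (card (park (?A - B) p)))"
    by simp
  also have "\<dots> = (\<Sum>B | B \<subseteq> ?A \<and> card B = k - 1.
      of_nat k ^ (k - 2) * (of_nat p ^ r - of_nat r * of_nat p ^ (r - 1)))"
  proof (rule sum.cong[OF refl])
    fix B assume "B \<in> {B. B \<subseteq> ?A \<and> card B = k - 1}"
    then have B: "B \<subseteq> ?A" "card B = k - 1" "finite B" by (auto intro: finite_subset)
    then have AB: "card (?A - B) = r" by (simp add: card_Diff_subset r_def)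
    have "k - 1 \<le> n" using card_mono[OF _ B(1)] B(2) by simp
    then have "r \<le> p" using n by (simp add: r_def)
    \<comment> \<open>For \<open>k \<ge> 2\<close> the formula is
      \<open>k ^ (k - 1) - (k - 1) * k ^ (k - 2)\<close>. For \<open>k = 1\<close> the truncated
      exponent gives the correct value \<open>1\<close>.\<close>
    have "(of_nat (card (park B k)) :: 'b) = of_nat k ^ (k - 2)"
    proof (cases "k = 1")
      case False
      with k obtain j where j: "k = Suc (Suc j)" by (metis One_nat_def not0_implies_Suc not_gr_zero)
      have "card B \<le> k" using B(2) by simp
      from card_park[OF B(3) this, where 'b = 'b] show ?thesis
        unfolding B(2) j by (simp add: algebra_simps)
    qed (use card_park[OF B(3), of k, where 'b = 'b] B(2) in simp)
    moreover have "(of_nat (card (park (?A - B) p)) :: 'b) = of_nat p ^ r - of_nat r * of_nat p ^ (r - 1)"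
      using card_park[of "?A - B" p, where 'b = 'b] AB \<open>r \<le> p\<close> by simp
    ultimately show "(of_nat (card (park B k)) * of_nat (card (park (?A - B) p)) :: 'b)
      = of_nat k ^ (k - 2) * (of_nat p ^ r - of_nat r * of_nat p ^ (r - 1))" by simp
  qed
  also have "\<dots> = ?R" by (simp add: n_subsets mult.assoc)
  finally show ?thesis .
qed

subsection \<open>Displacement of the last key\<close>

text \<open>If \<open>m\<close> is empty, exactly the addresses after the last empty bucket lead to
  \<open>m\<close>, and address \<open>a\<close> gives displacement \<open>m - a\<close>. If
  \<open>m\<close> is occupied, no key can land there, because the empty bucket \<open>b\<close>
  makes the probe stop elsewhere.\<close>

lemma sum_landing_last:
  assumes "b \<in> {1..m}" "b \<notin> B"
  shows "(\<Sum>a | a \<in> {1..m} \<and> probe m a (probe_steps m B a) = m. F (probe_steps m B a))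
    = (if m \<in> B then 0 else \<Sum>d<m - last_empty m B. F d)"
proof (cases "m \<in> B")
  case True
  have "probe m a (probe_steps m B a) \<noteq> m" if "a \<in> {1..m}" for a
    using probe_steps_notin[OF that assms] True by metis
  then have "{a. a \<in> {1..m} \<and> probe m a (probe_steps m B a) = m} = {}" by blast
  then show ?thesis using True by (simp only: sum.empty if_True)
next
  case False
  define p where "p = last_empty m B"
  have p: "p < m" "p = 0 \<or> p \<notin> B" "{p<..<m} \<subseteq> B"
    using last_empty_iff[of m B p] assms(1) by (auto simp: p_def)
  have iff: "a + probe_steps m B a = m \<longleftrightarrow> p < a" if a: "a \<in> {1..m}" for a
  proof
    assume "a + probe_steps m B a = m"
    with linear_landing(3)[OF False a] have "{a..<m} \<subseteq> B" by simp
    then have "p \<notin> {a..<m}" if "0 < p" using p(2) that by blast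
    then show "p < a" using p(1) a by (cases "p = 0") auto
  next
    assume "p < a"
    with linear_landing(1,4)[OF False a] p(3) show "a + probe_steps m B a = m"
      by (metis greaterThanLessThan_iff le_neq_implies_less subsetD trans_less_add1)
  qed
  then have "{a. a \<in> {1..m} \<and> probe m a (probe_steps m B a) = m} = {p<..m}"
    using linear_landing(2)[OF False] by fastforce
  then have "(\<Sum>a | a \<in> {1..m} \<and> probe m a (probe_steps m B a) = m. F (probe_steps m B a))
      = (\<Sum>a\<in>{p<..m}. F (probe_steps m B a))" by (rule arg_cong)
  also have "\<dots> = (\<Sum>a\<in>{p<..m}. F (m - a))"
  proof (rule sum.cong[OF refl])
    fix a assume "a \<in> {p<..m}"
    then have "a + probe_steps m B a = m" using iff[of a] by simp
    then show "F (probe_steps m B a) = F (m - a)" by (metis add_diff_cancel_left')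
  qed
  also have "\<dots> = (\<Sum>d<m - p. F d)"
    by (rule sum.reindex_bij_witness[of _ "\<lambda>d. m - d" "\<lambda>a. m - a"]) auto
  finally show ?thesis using False by (simp add: p_def)
qed

text \<open>With the first \<open>n\<close> keys fixed, the sum over the last address depends only
  on the last empty bucket before \<open>m\<close>; the tables are then grouped by it.\<close>

lemma sum_last_key:
  fixes F :: "nat \<Rightarrow> 'b::comm_ring_1"
  assumes n: "n < m"
  shows "(\<Sum>h | h \<in> {1..Suc n} \<rightarrow>\<^sub>E {1..m} \<and> bucket m h (Suc n) = m. F (displacement m h (Suc n)))
    = (\<Sum>p<m. (\<Sum>d<m - p. F d) * of_nat (card {g \<in> {1..n} \<rightarrow>\<^sub>E {1..m}.
         m \<notin> occupied m g n \<and> last_empty m (occupied m g n) = p}))"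
proof -
  let ?S = "\<lambda>n::nat. {1..n} \<rightarrow>\<^sub>E {1..m}"
  let ?O = "\<lambda>g. occupied m g n"
  let ?W = "\<lambda>p. \<Sum>d<m - p. F d"
  have fin: "finite (?S n)" for n by (simp add: finite_PiE)
  have upd: "displacement m (g(Suc n := a)) (Suc n) = probe_steps m (?O g) a"
    "bucket m (g(Suc n := a)) (Suc n) = probe m a (probe_steps m (?O g) a)" for g a
  proof -
    have "occupied m (g(Suc n := a)) n = ?O g" by (rule occupied_cong) simp
    then show "displacement m (g(Suc n := a)) (Suc n) = probe_steps m (?O g) a"
      by (simp add: displacement_def)
    then show "bucket m (g(Suc n := a)) (Suc n) = probe m a (probe_steps m (?O g) a)"
      by (simp add: bucket_def)
  qed
  have "(\<Sum>h | h \<in> ?S (Suc n) \<and> bucket m h (Suc n) = m. F (displacement m h (Suc n)))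
     = (\<Sum>h\<in>?S (Suc n). if bucket m h (Suc n) = m then F (displacement m h (Suc n)) else 0)"
    using sum.inter_filter[OF fin[of "Suc n"]] by simp
  also have "\<dots> = (\<Sum>g\<in>?S n. \<Sum>a\<in>{1..m}.
      if probe m a (probe_steps m (?O g) a) = m then F (probe_steps m (?O g) a) else 0)"
    unfolding sum_PiE_Suc upd ..
  also have "\<dots> = (\<Sum>g\<in>?S n. \<Sum>a | a \<in> {1..m} \<and> probe m a (probe_steps m (?O g) a) = m.
      F (probe_steps m (?O g) a))"
    by (intro sum.cong refl sum.inter_filter[symmetric]) simp
  also have "\<dots> = (\<Sum>g\<in>?S n. if m \<in> ?O g then 0 else ?W (last_empty m (?O g)))"
  proof (rule sum.cong[OF refl])
    fix g
    \<comment> \<open>Fewer keys than buckets leave some bucket empty, as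
      \<open>sum_landing_last\<close> requires.\<close>
    have "card (?O g) \<le> n" unfolding occupied_eq_bucket using card_image_le[of "{1..n}"] by simp
    then have "card (?O g) < card {1..m}" using n by simp
    moreover have "finite (?O g)" unfolding occupied_eq_bucket by simp
    ultimately obtain b where "b \<in> {1..m}" "b \<notin> ?O g"
      by (meson card_mono not_less subsetI)
    then show "(\<Sum>a | a \<in> {1..m} \<and> probe m a (probe_steps m (?O g) a) = m.
      F (probe_steps m (?O g) a)) = (if m \<in> ?O g then 0 else ?W (last_empty m (?O g)))"
      by (rule sum_landing_last)
  qed
  also have "\<dots> = (\<Sum>g\<in>?S n. if m \<notin> ?O g then ?W (last_empty m (?O g)) else 0)"
    by (intro sum.cong refl) simp
  also have "\<dots> = (\<Sum>g | g \<in> ?S n \<and> m \<notin> ?O g. ?W (last_empty m (?O g)))"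
    by (rule sum.inter_filter[OF fin, symmetric])
  also have "\<dots> = (\<Sum>p<m. \<Sum>g | g \<in> {g. g \<in> ?S n \<and> m \<notin> ?O g} \<and> last_empty m (?O g) = p.
      ?W (last_empty m (?O g)))"
  proof (rule sum.group[symmetric])
    show "(\<lambda>g. last_empty m (?O g)) ` {g. g \<in> ?S n \<and> m \<notin> ?O g} \<subseteq> {..<m}"
      using last_empty_iff[of m] n by auto
    show "finite {g. g \<in> ?S n \<and> m \<notin> ?O g}" by (rule finite_subset[OF _ fin[of n]]) blast
  qed simp
  also have "\<dots> = (\<Sum>p<m. ?W p * of_nat (card {g \<in> ?S n. m \<notin> ?O g \<and> last_empty m (?O g) = p}))"
    by (intro sum.cong refl) (simp add: conj_assoc mult.commute)
  finally show ?thesis .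
qed

section \<open>From full tables to tables ending with the marked key\<close>

lemma sum_PiE_prefix:
  fixes f :: "(nat \<Rightarrow> 'c) \<Rightarrow> 'b::comm_semiring_1"
  assumes "\<And>g h. (\<And>y. y \<in> {1..x} \<Longrightarrow> g y = h y) \<Longrightarrow> f g = f h"
  shows "(\<Sum>h\<in>{1..x + j} \<rightarrow>\<^sub>E C. f h) = of_nat (card C) ^ j * (\<Sum>h\<in>{1..x} \<rightarrow>\<^sub>E C. f h)"
proof (induction j)
  case (Suc j)
  have "f (g(Suc (x + j) := a)) = f g" for g a by (rule assms) simp
  then have "(\<Sum>h\<in>{1..Suc (x + j)} \<rightarrow>\<^sub>E C. f h) = of_nat (card C) * (\<Sum>h\<in>{1..x + j} \<rightarrow>\<^sub>E C. f h)"
    unfolding sum_PiE_Suc by (simp add: sum_distrib_left)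
  then show ?case using Suc by (simp add: mult.assoc)
qed simp

lemma full_tables_eq: "full_tables m = {h. h \<in> {1..m} \<rightarrow>\<^sub>E {1..m} \<and> bucket m h m = m}"
  by (simp add: full_tables_def)

text \<open>Rotation is used twice: it removes the condition on key \<open>m\<close>, and, once the
  free keys after \<open>x\<close> are summed out, it imposes the same condition on key
  \<open>x\<close>. The two factors \<open>m\<close> cancel.\<close>

lemma sum_displacement_full_tables:
  fixes q :: "'a::field_char_0"
  assumes x: "x \<in> {1..m}"
  shows "(\<Sum>h\<in>full_tables m. q ^ displacement m h x)
    = of_nat m ^ (m - x) *
      (\<Sum>h | h \<in> {1..x} \<rightarrow>\<^sub>E {1..m} \<and> bucket m h x = m. q ^ displacement m h x)"
proof -
  have m: "0 < m" and x1: "1 \<le> x" and mx: "x + (m - x) = m" using x by auto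
  have inv: "q ^ displacement m (restrict (rot m \<circ> h) {1..n}) x = q ^ displacement m h x"
    if n: "x \<le> n" and h: "h \<in> {1..n} \<rightarrow>\<^sub>E {1..m}" for n h
  proof -
    have "displacement m (restrict (rot m \<circ> h) {1..n}) x = displacement m (rot m \<circ> h) x"
      using n by (intro displacement_cong[OF _ x1]) simp
    also have "\<dots> = displacement m h x"
    proof (rule displacement_rot[OF m x1])
      fix y assume "y \<in> {1..x}"
      then have "y \<in> {1..n}" using n by simp
      then show "1 \<le> h y" using PiE_mem[OF h] by simp
    qed
    finally show ?thesis by (rule arg_cong)
  qed
  have "of_nat m * (\<Sum>h\<in>full_tables m. q ^ displacement m h x)
      = (\<Sum>h\<in>{1..m} \<rightarrow>\<^sub>E {1..m}. q ^ displacement m h x)"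
    unfolding full_tables_eq using x inv m by (intro sum_by_last_bucket[symmetric]) auto
  also have "\<dots> = of_nat (card {1..m}) ^ (m - x) * (\<Sum>h\<in>{1..x} \<rightarrow>\<^sub>E {1..m}. q ^ displacement m h x)"
  proof -
    have "q ^ displacement m g x = q ^ displacement m h x" if "\<And>y. y \<in> {1..x} \<Longrightarrow> g y = h y" for g h
      by (rule arg_cong[OF displacement_cong[OF that x1]])
    from sum_PiE_prefix[of x "\<lambda>h. q ^ displacement m h x" "m - x" "{1..m}", OF this]
    show ?thesis unfolding mx by simp
  qed
  also have "(\<Sum>h\<in>{1..x} \<rightarrow>\<^sub>E {1..m}. q ^ displacement m h x) = of_nat m *
      (\<Sum>h | h \<in> {1..x} \<rightarrow>\<^sub>E {1..m} \<and> bucket m h x = m. q ^ displacement m h x)"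
    by (rule sum_by_last_bucket[OF m x1], rule inv[OF order_refl])
  finally show ?thesis using m by (simp add: mult.left_commute)
qed

text \<open>Rotation applied to the constant \<open>1\<close>. This is the direct count with which
  \<open>abel_identity\<close> compares the case \<open>q = 1\<close>.\<close>

lemma card_full_tables:
  assumes "0 < m"
  shows "(of_nat m * of_nat (card (full_tables m)) :: 'a::comm_semiring_1) = of_nat m ^ m"
proof -
  have "(\<Sum>h\<in>{1..m} \<rightarrow>\<^sub>E {1..m}. 1 :: 'a) = of_nat m * (\<Sum>h\<in>full_tables m. 1)"
    unfolding full_tables_eq using assms by (intro sum_by_last_bucket) auto
  then show ?thesis by (simp add: card_PiE)
qed

text \<open>The sum over the marked key, for a block of \<open>Suc c\<close> buckets ending at
  \<open>m = p + Suc c\<close>: here \<open>c + i\<close> keys precede it, \<open>i\<close> of them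
  in the lower piece, and the \<open>p - i\<close> later keys are free. The partial sums have the
  closed form \<open>partial\<close>.\<close>

lemma telescoped_binomial_sum:
  "(\<Sum>i\<le>p. of_nat (p + Suc c) ^ (p - i) * (of_nat (c + i choose c) *
      (of_nat p ^ i - of_nat i * of_nat p ^ (i - 1))))
    = (of_nat (p + Suc c choose Suc c) * of_nat p ^ p :: 'a::field_char_0)"
proof (cases "p = 0")
  case False
  let ?m = "of_nat (p + Suc c) :: 'a"
  let ?t = "\<lambda>i. ?m ^ (p - i) * (of_nat (c + i choose c) *
      (of_nat p ^ i - of_nat i * of_nat p ^ (i - 1)))"
  \<comment> \<open>Multiplying by \<open>p\<close> removes the truncated exponent
    \<open>i - 1\<close>, which makes the telescoping visible.\<close>
  have pow: "of_nat p * (of_nat p ^ i - of_nat i * of_nat p ^ (i - 1))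
      = (of_nat p - of_nat i) * (of_nat p ^ i :: 'a)" for i
    by (cases i) (simp_all add: algebra_simps)
  have partial: "of_nat p * (\<Sum>i<j. ?t i) = ?m ^ (Suc p - j) * of_nat p ^ j * of_nat (c + j choose Suc c)"
    if "j \<le> p" for j
    using that
  proof (induction j)
    case (Suc j)
    have "Suc c * (c + j choose Suc c) = j * (c + j choose c)"
      using binomial_absorption[of c "c + j"] binomial_absorb_comp[of "c + j" c] by simp
    then have "of_nat (Suc c) * of_nat (c + j choose Suc c) = of_nat j * (of_nat (c + j choose c) :: 'a)"
      by (simp only: of_nat_mult[symmetric])
    \<comment> \<open>Splitting \<open>?m\<close> as \<open>p + Suc c\<close>, the absorption
      identity cancels the terms with \<open>Suc c\<close> and \<open>j\<close>; Pascal's rule joins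
      the rest.\<close>
    then have bin: "?m * of_nat (c + j choose Suc c) + (of_nat p - of_nat j) * of_nat (c + j choose c)
        = of_nat p * (of_nat (c + Suc j choose Suc c) :: 'a)"
      by (simp add: algebra_simps)
    have "of_nat p * ?t j = ?m ^ (p - j) * of_nat (c + j choose c) *
        (of_nat p * (of_nat p ^ j - of_nat j * of_nat p ^ (j - 1)))"
      by (simp only: mult_ac)
    then have "of_nat p * ?t j = ?m ^ (p - j) * of_nat p ^ j *
        ((of_nat p - of_nat j) * of_nat (c + j choose c))"
      unfolding pow by (simp only: mult_ac)
    moreover have "of_nat p * (\<Sum>i<j. ?t i) = ?m ^ (p - j) * of_nat p ^ j * (?m * of_nat (c + j choose Suc c))"
      using Suc by (simp add: Suc_diff_le mult_ac)
    ultimately have "of_nat p * (\<Sum>i<Suc j. ?t i) = ?m ^ (p - j) * of_nat p ^ j *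
       (?m * of_nat (c + j choose Suc c) + (of_nat p - of_nat j) * of_nat (c + j choose c))"
      by (simp only: sum.lessThan_Suc distrib_left)
    also have "\<dots> = ?m ^ (Suc p - Suc j) * of_nat p ^ Suc j * of_nat (c + Suc j choose Suc c)"
      unfolding bin by (simp only: diff_Suc_Suc power_Suc mult_ac)
    finally show ?case .
  qed simp
  have "(p + Suc c) * (c + p choose Suc c) = p * (p + Suc c choose Suc c)"
    using binomial_absorb_comp[of "p + Suc c" "Suc c"] by (simp add: add.commute)
  then have bin: "?m * of_nat (c + p choose Suc c) = of_nat p * of_nat (p + Suc c choose Suc c)"
    by (simp only: of_nat_mult[symmetric])
  \<comment> \<open>The summand at \<open>i = p\<close> vanishes, so \<open>partial\<close> at
    \<open>j = p\<close> already gives the whole sum.\<close>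
  have "of_nat p ^ p - of_nat p * of_nat p ^ (p - 1) = (0 :: 'a)"
    using False by (simp flip: power_Suc)
  then have "(\<Sum>i\<le>p. ?t i) = (\<Sum>i<p. ?t i)"
    by (simp flip: lessThan_Suc_atMost)
  then have "of_nat p * (\<Sum>i\<le>p. ?t i) = of_nat p ^ p * (?m * of_nat (c + p choose Suc c))"
    using partial[of p] by (simp only: order_refl Suc_diff_le diff_self_eq_0 power_Suc power_0 mult_ac mult_1_right mult_1_left)
  then have "of_nat p * (\<Sum>i\<le>p. ?t i) = of_nat p * (of_nat (p + Suc c choose Suc c) * of_nat p ^ p)"
    unfolding bin by (simp only: mult_ac)
  then show ?thesis using False by simp
qed simp

subsection \<open>Generating functions\<close>

text \<open>The marked key is \<open>Suc n\<close>. Its displacement sum \<open>G p\<close> does not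
  depend on \<open>n\<close>, so after exchanging the sums only the counts \<open>K n p\<close> are
  summed over \<open>n\<close>, and these telescope.\<close>

lemma sum_full_tables:
  fixes q :: "'a::field_char_0"
  assumes m: "0 < m"
  shows "(\<Sum>(h, x)\<in>full_tables m \<times> {1..m}. q ^ displacement m h x)
    = (\<Sum>p<m. of_nat (m choose p) * of_nat p ^ p *
        (of_nat (m - p) ^ (m - p - 2) * (\<Sum>d<m - p. q ^ d)))"
proof -
  define G where "G = (\<lambda>p. \<Sum>d<m - p. q ^ d)"
  define K where "K = (\<lambda>n p. (of_nat (n choose (m - p - 1)) * of_nat (m - p) ^ (m - p - 2) *
     (of_nat p ^ (n - (m - p - 1)) - of_nat (n - (m - p - 1)) * of_nat p ^ (n - (m - p - 1) - 1)) :: 'a))"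
  have last: "(\<Sum>h | h \<in> {1..Suc n} \<rightarrow>\<^sub>E {1..m} \<and> bucket m h (Suc n) = m. q ^ displacement m h (Suc n))
      = (\<Sum>p<m. G p * K n p)" if n: "n < m" for n
    unfolding sum_last_key[OF n, of "\<lambda>d. q ^ d"] G_def
  proof (intro sum.cong refl arg_cong2[where f = "(*)"])
    fix p assume "p \<in> {..<m}"
    then have *: "n < p + (m - p)" "0 < m - p" "p + (m - p) = m" using n by simp_all
    show "of_nat (card {g \<in> {1..n} \<rightarrow>\<^sub>E {1..m}. m \<notin> occupied m g n \<and> last_empty m (occupied m g n) = p})
      = K n p"
      using card_last_empty[OF *(1,2), where 'b = 'a] unfolding *(3) K_def .
  qed
  have inner: "(\<Sum>n<m. of_nat m ^ (m - Suc n) * K n p)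
      = of_nat (m choose p) * of_nat p ^ p * of_nat (m - p) ^ (m - p - 2)" if p: "p < m" for p
  proof -
    obtain c where c: "m = p + Suc c" using p less_imp_Suc_add by fastforce
    have mp: "m - p - 1 = c" "m - p = Suc c" by (simp_all add: c)
    \<comment> \<open>Fewer than \<open>c\<close> earlier keys cannot fill the \<open>c\<close>
      buckets between \<open>p\<close> and \<open>m\<close>; in \<open>K\<close> the binomial
      coefficient is then \<open>0\<close>.\<close>
    have "(\<Sum>n<m. of_nat m ^ (m - Suc n) * K n p) = (\<Sum>n\<in>{c..<m}. of_nat m ^ (m - Suc n) * K n p)"
    proof (rule sum.mono_neutral_right)
      show "\<forall>n\<in>{..<m} - {c..<m}. of_nat m ^ (m - Suc n) * K n p = 0"
      proof
        fix n assume "n \<in> {..<m} - {c..<m}"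
        then have "n < c" by auto
        then have "n choose (m - p - 1) = 0" unfolding mp(1) by (rule binomial_eq_0)
        then show "of_nat m ^ (m - Suc n) * K n p = 0" unfolding K_def by simp
      qed
    qed auto
    also have "\<dots> = (\<Sum>i\<le>p. of_nat m ^ (m - Suc (c + i)) * K (c + i) p)"
      by (rule sum.reindex_bij_witness[of _ "\<lambda>i. c + i" "\<lambda>n. n - c"]) (auto simp: c)
    also have "\<dots> = (\<Sum>i\<le>p. of_nat (Suc c) ^ (m - p - 2) * (of_nat (p + Suc c) ^ (p - i) *
       (of_nat (c + i choose c) * (of_nat p ^ i - of_nat i * of_nat p ^ (i - 1)))))"
    proof (rule sum.cong[OF refl])
      fix i
      have "m - Suc (c + i) = p - i" by (simp add: c)
      then show "of_nat m ^ (m - Suc (c + i)) * K (c + i) p = of_nat (Suc c) ^ (m - p - 2) *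
         (of_nat (p + Suc c) ^ (p - i) *
         (of_nat (c + i choose c) * (of_nat p ^ i - of_nat i * of_nat p ^ (i - 1))))"
        unfolding K_def mp(1) unfolding mp(2) c[symmetric] by (simp only: diff_add_inverse mult_ac)
    qed
    also have "\<dots> = of_nat (Suc c) ^ (m - p - 2) * (of_nat (m choose Suc c) * of_nat p ^ p)"
      unfolding sum_distrib_left[symmetric] telescoped_binomial_sum unfolding c[symmetric] ..
    also have "m choose Suc c = m choose p"
      using binomial_symmetric[of p m] p by (simp add: c)
    finally show ?thesis unfolding mp(2) by (simp only: mult_ac)
  qed
  have "(\<Sum>(h, x)\<in>full_tables m \<times> {1..m}. q ^ displacement m h x)
      = (\<Sum>h\<in>full_tables m. \<Sum>x\<in>{1..m}. q ^ displacement m h x)"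
    by (rule sum.cartesian_product[symmetric])
  also have "\<dots> = (\<Sum>x\<in>{1..m}. \<Sum>h\<in>full_tables m. q ^ displacement m h x)"
    by (rule sum.swap)
  also have "\<dots> = (\<Sum>n<m. \<Sum>h\<in>full_tables m. q ^ displacement m h (Suc n))"
    by (rule sum.reindex_bij_witness[of _ Suc "\<lambda>x. x - 1"]) auto
  also have "\<dots> = (\<Sum>n<m. \<Sum>p<m. G p * (of_nat m ^ (m - Suc n) * K n p))"
  proof (rule sum.cong[OF refl])
    fix n assume "n \<in> {..<m}"
    then have n: "n < m" "Suc n \<in> {1..m}" by simp_all
    show "(\<Sum>h\<in>full_tables m. q ^ displacement m h (Suc n)) =
        (\<Sum>p<m. G p * (of_nat m ^ (m - Suc n) * K n p))"
      unfolding sum_displacement_full_tables[OF n(2)] last[OF n(1)] sum_distrib_left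
      by (intro sum.cong refl) (simp only: mult_ac)
  qed
  also have "\<dots> = (\<Sum>p<m. G p * (\<Sum>n<m. of_nat m ^ (m - Suc n) * K n p))"
    unfolding sum_distrib_left by (rule sum.swap)
  also have "\<dots> = (\<Sum>p<m. of_nat (m choose p) * of_nat p ^ p * (of_nat (m - p) ^ (m - p - 2) * G p))"
    by (intro sum.cong refl) (simp only: inner lessThan_iff, simp only: mult_ac)
  finally show ?thesis by (simp only: G_def)
qed

text \<open>Comparing the case \<open>q = 1\<close> of the count with the number of full tables proves Abel's identity.\<close>

lemma abel_identity:
  assumes m: "0 < m"
  shows "(\<Sum>p<m. of_nat (m choose p) * of_nat p ^ p * of_nat (m - p) ^ (m - p - 1))
    = (of_nat m ^ m :: 'a::field_char_0)"
proof -
  \<comment> \<open>At \<open>k = 1\<close> both exponents are \<open>0\<close>, so truncated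
    subtraction does no harm.\<close>
  have pow: "of_nat k ^ (k - 2) * of_nat k = (of_nat k ^ (k - 1) :: 'a)" if "0 < k" for k
  proof (cases "k = 1")
    case False
    with that obtain j where "k = Suc (Suc j)" by (metis One_nat_def not0_implies_Suc not_gr_zero)
    then show ?thesis by simp
  qed simp
  have "(of_nat m ^ m :: 'a) = of_nat m * of_nat (card (full_tables m))"
    by (rule card_full_tables[OF m, symmetric])
  also have "\<dots> = (\<Sum>(h, x)\<in>full_tables m \<times> {1..m}. 1 ^ displacement m h x)"
    by (simp add: case_prod_unfold card_cartesian_product mult.commute)
  also have "\<dots> = (\<Sum>p<m. of_nat (m choose p) * of_nat p ^ p *
        (of_nat (m - p) ^ (m - p - 2) * of_nat (m - p)))"
    unfolding sum_full_tables[OF m] by simp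
  also have "\<dots> = (\<Sum>p<m. of_nat (m choose p) * of_nat p ^ p * of_nat (m - p) ^ (m - p - 1))"
    by (intro sum.cong refl) (simp only: pow lessThan_iff zero_less_diff)
  finally show ?thesis by simp
qed

section \<open>Abel's identity as relations between power series, and the closed form\<close>

unbundle fps_syntax

lemma T_nth: "T c $ n = (if n = 0 then 0 else of_nat n ^ (n - 1) * c ^ n / fact n)"
  by (simp add: T_def tree_fps_def fps_compose_linear)

text \<open>\<open>W = 1 + z T'\<close>, and \<open>U = T - T\<^sup>2 / 2\<close>.\<close>

definition W :: "'a::field_char_0 \<Rightarrow> 'a fps" where
  "W c = Abs_fps (\<lambda>n. of_nat n ^ n * c ^ n / fact n)"

definition U :: "'a::field_char_0 \<Rightarrow> 'a fps" where
  "U c = Abs_fps (\<lambda>n. if n = 0 then 0 else of_nat n ^ (n - 2) * c ^ n / fact n)"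

text \<open>Coefficientwise, Abel's identity says that \<open>W c * T c = W c - 1\<close>.\<close>

lemma W_times_one_minus_T: "W c * (1 - T c) = 1"
proof (rule fps_ext)
  fix m
  have WT: "W c $ i * T c $ (m - i) = c ^ m / fact m *
      (of_nat (m choose i) * of_nat i ^ i * of_nat (m - i) ^ (m - i - 1))" if "i < m" for i
  proof -
    have "c ^ m = c ^ i * c ^ (m - i)" using that by (simp flip: power_add)
    moreover have "of_nat (m choose i) = (fact m / (fact i * fact (m - i)) :: 'a)"
      using that by (simp add: binomial_fact)
    ultimately show ?thesis using that by (simp add: W_def T_nth)
  qed
  have "(W c * T c) $ m = (\<Sum>i<m. W c $ i * T c $ (m - i))"
    by (simp add: fps_mult_nth atLeast0AtMost T_nth flip: lessThan_Suc_atMost)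
  also have "\<dots> = c ^ m / fact m *
      (\<Sum>p<m. of_nat (m choose p) * of_nat p ^ p * of_nat (m - p) ^ (m - p - 1))"
    unfolding sum_distrib_left by (rule sum.cong[OF refl]) (simp only: WT lessThan_iff)
  also have "\<dots> = (if m = 0 then 0 else W c $ m)"
  proof (cases "m = 0")
    case False
    then have "0 < m" by simp
    from abel_identity[OF this, where 'a = 'a] False show ?thesis by (simp only: W_def fps_nth_Abs_fps) simp
  qed simp
  finally show "(W c * (1 - T c)) $ m = 1 $ m"
    by (simp add: right_diff_distrib W_def)
qed

text \<open>Both sides have constant term \<open>1\<close> and the same image under
  \<open>fps_X * fps_deriv\<close>: on the left \<open>-2 * (1 - T c) * (W c - 1)\<close>, which is
  \<open>-2 * T c\<close> because \<open>W c\<close> inverts \<open>1 - T c\<close>.\<close>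

lemma one_minus_T_square: "(1 - T c) ^ 2 = 1 - 2 * U c"
proof -
  have dT: "fps_X * fps_deriv (T c) = W c - 1"
  proof (rule fps_ext)
    fix n show "(fps_X * fps_deriv (T c)) $ n = (W c - 1) $ n"
      by (cases n) (simp_all add: T_nth W_def)
  qed
  have dU: "fps_X * fps_deriv (U c) = T c"
  proof (rule fps_ext)
    fix n show "(fps_X * fps_deriv (U c)) $ n = T c $ n"
    proof (cases n)
      case (Suc k)
      then show ?thesis by (cases k) (simp_all add: T_nth U_def)
    qed (simp add: T_nth)
  qed
  have "fps_X * fps_deriv ((1 - T c) ^ 2) = - 2 * ((1 - T c) * (fps_X * fps_deriv (T c)))"
    by (simp add: power2_eq_square algebra_simps)
  also have "\<dots> = - 2 * (W c * (1 - T c) - (1 - T c))"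
    unfolding dT by (simp add: algebra_simps)
  also have "\<dots> = fps_X * fps_deriv (1 - 2 * U c)"
    unfolding W_times_one_minus_T by (simp add: dU mult.left_commute[of fps_X])
  finally have "fps_deriv ((1 - T c) ^ 2) = fps_deriv (1 - 2 * U c)"
    by (simp only: mult_cancel_left fps_X_neq_zero simp_thms)
  then show ?thesis
    unfolding fps_deriv_eq_iff by (simp add: T_nth U_def power2_eq_square)
qed

theorem theorem12p4:
  fixes w q :: "'a::field_char_0"
  assumes "q \<noteq> 1"
  shows "FC0 w q =
    ((1 - T (w * q)) ^ 2 - (1 - T w) ^ 2) / (2 * (1 - fps_const q) * (1 - T w))"
proof -
  \<comment> \<open>\<open>H\<close> is the exponential series of the block ending at bucket
    \<open>m\<close>, weighted by the displacements of the key landing there. The empty sum makes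
    its constant term \<open>0\<close>.\<close>
  define H where "H = Abs_fps (\<lambda>k. of_nat k ^ (k - 2) * (\<Sum>d<k. q ^ d) * w ^ k / fact k)"
  have FC0: "FC0 w q = W w * H"
  proof (rule fps_ext)
    fix m
    show "FC0 w q $ m = (W w * H) $ m"
    proof (cases "m = 0")
      case False
      have "(W w * H) $ m = (\<Sum>p<m. W w $ p * H $ (m - p))"
        by (simp add: fps_mult_nth atLeast0AtMost H_def flip: lessThan_Suc_atMost)
      also have "\<dots> = (\<Sum>p<m. (of_nat (m choose p) * of_nat p ^ p *
          (of_nat (m - p) ^ (m - p - 2) * (\<Sum>d<m - p. q ^ d))) * (w ^ m / fact m))"
      proof (rule sum.cong[OF refl])
        fix p assume p: "p \<in> {..<m}"
        then have "w ^ m = w ^ p * w ^ (m - p)" by (simp flip: power_add)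
        moreover have "of_nat (m choose p) = (fact m / (fact p * fact (m - p)) :: 'a)"
          using p by (simp add: binomial_fact)
        ultimately show "W w $ p * H $ (m - p) = (of_nat (m choose p) * of_nat p ^ p *
          (of_nat (m - p) ^ (m - p - 2) * (\<Sum>d<m - p. q ^ d))) * (w ^ m / fact m)"
          by (simp add: W_def H_def)
      qed
      also have "\<dots> = FC0 w q $ m"
      proof -
        have "FC0 w q $ m = (\<Sum>(h, x)\<in>full_tables m \<times> {1..m}. q ^ displacement m h x) * (w ^ m / fact m)"
          using False by (simp add: FC0_def)
        also have "0 < m" using False by simp
        note sum_full_tables[OF this]
        finally show ?thesis unfolding sum_distrib_right by (rule sym)
      qed
      finally show ?thesis by (rule sym)
    qed (simp add: FC0_def H_def)
  qed
  \<comment> \<open>The factor \<open>1 - q\<close> turns the geometric sum into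
    \<open>1 - q ^ k\<close>, hence \<open>H\<close> into a difference of two values of
    \<open>U\<close>.\<close>
  have UH: "U w - U (w * q) = (1 - fps_const q) * H"
  proof (rule fps_ext)
    fix k
    have "((1 - fps_const q) * H) $ k = ((1 - q) * (\<Sum>d<k. q ^ d)) * (of_nat k ^ (k - 2) * w ^ k / fact k)"
      by (simp add: left_diff_distrib right_diff_distrib H_def diff_divide_distrib mult_ac)
    also have "(1 - q) * (\<Sum>d<k. q ^ d) = 1 - q ^ k" by (rule one_diff_power_eq[symmetric])
    finally show "(U w - U (w * q)) $ k = ((1 - fps_const q) * H) $ k"
      by (cases "k = 0") (simp_all add: U_def H_def power_mult_distrib algebra_simps diff_divide_distrib)
  qed
  \<comment> \<open>The constant term is \<open>2 * (1 - q)\<close>, nonzero because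
    \<open>q \<noteq> 1\<close>; this allows the division.\<close>
  have "(2 * (1 - fps_const q) * (1 - T w)) $ 0 \<noteq> 0"
    using assms by (simp add: T_nth)
  then have nz: "2 * (1 - fps_const q) * (1 - T w) \<noteq> 0" by (metis fps_zero_nth)
  have "(1 - T (w * q)) ^ 2 - (1 - T w) ^ 2 = 2 * (U w - U (w * q))"
    unfolding one_minus_T_square by (simp add: algebra_simps)
  \<comment> \<open>The factor \<open>W w * (1 - T w)\<close> equals \<open>1\<close> and is
    inserted so that \<open>W w * H\<close> appears.\<close>
  also have "\<dots> = 2 * (1 - fps_const q) * H * (W w * (1 - T w))"
    unfolding UH W_times_one_minus_T by (simp add: mult.assoc)
  also have "\<dots> = FC0 w q * (2 * (1 - fps_const q) * (1 - T w))"
    unfolding FC0 by (simp only: mult_ac)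
  finally show ?thesis using nz by simp
qed

end
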